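(* Let $F$ be a deterministic, single-outputting p-filter all of whose states are reachable from its initial state. Call a clique cover of the compatibility graph $G(F)$ an MCCA solution if it satisfies $\mathrm{Zip}(F)$ and has minimum cardinality among all clique covers of $G(F)$ satisfying $\mathrm{Zip}(F)$. Call a deterministic p-filter an SO-FM solution if it output simulates $F$ and has the fewest states among all deterministic p-filters output simulating $F$. Then: (i) for every MCCA solution $\mathcal K$, the induced filter $M(F,\mathcal K)$ is an SO-FM solution; (ii) for every SO-FM solution $F^\star$, the induced clique cover $\mathcal Q(F,F^\star)$ is an MCCA solution.
   Context: A p-filter is a tuple $F=(V,V_0,Y,\tau,C,c)$ with the following components: $V$ is a finite set of states; $\emptyset\neq V_0\subseteq V$ is the set of initial states; $Y$ is a set of observations; $\tau:V\times V\to 2^Y$ is the transition function; $C$ is an output space; and $c:V\to 2^C\setminus\{\emptyset\}$ is the output function. $F$ is single-outputting if $|c(v)|=1$ for all $v$. For $s=y_1\cdots y_n\in Y^*$ and $w_0\in V$, let $V_F(w_0,s)$ be the set of states $w_n$ for which there exist $w_1,\dots,w_n$ with $y_i\in\tau(w_{i-1},w_i)$ for all $i$. Let $V_F(s)=\bigcup_{v_0\in V_0}V_F(v_0,s)$. Let $E_F(v)=\{s:V_F(v,s)\neq\emptyset\}$, $L(F)=\bigcup_{v_0\in V_0}E_F(v_0)$, $C_F(s)=\bigcup_{v\in V_F(s)}c(v)$, and $S_F(v)=\{s:v\in V_F(s)\}$. $F'$ output simulates $F$ if, for all $s\in L(F)$, $C_{F'}(s)\neq\emptyset$ and $C_{F'}(s)\subseteq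 C_F(s)$. $F$ is deterministic if $|V_0|=1$ and, for all $v_1,v_2,v_3$ with $v_2\neq v_3$, $\tau(v_1,v_2)\cap\tau(v_1,v_3)=\emptyset$. States $v,w$ are compatible if, for all $s\in E_F(v)\cap E_F(w)$, all $v'\in V_F(v,s)$ and all $w'\in V_F(w,s)$, we have $c(v')=c(w')$. A set is mutually compatible if all its pairs are compatible. The compatibility graph $G(F)$ has vertex set $V(F)$ and an edge between each pair of distinct compatible states. Its cliques are the mutually compatible sets. A clique cover is a collection of cliques with union $V(F)$. The zipper constraints $\mathrm{Zip}(F)$ are all $(U,W)_y$ with $y\in Y$, $U,W\subseteq V$ mutually compatible, and $W=\{w:y\in\tau(u,w)\text{ for some }u\in U\}$. $\mathcal K$ satisfies $\mathrm{Zip}(F)$ if, for every $(U,W)_y\in\mathrm{Zip}(F)$ such that $U\subseteq K_s$ for some $K_s\in\mathcal K$, there is $K_t\in\mathcal K$ with $W\subseteq K_t$. The induced filter $M(F,\mathcal K)=(V',V_0',Y,\tau',C,c')$ is defined as follows: (1) $V'$ has one vertex $v'$ per clique $K_{v'}\in\mathcal K$. (2) $v'\in V_0'$ iff $K_{v'}$ contains an initial state of $F$. (3) $c'(v')=\bigcap_{v\in K_{v'}}c(v)$. (4) Initially $\tau'(v',w')=\bigcup_{v\in K_{v'},w\in K_{w'}}\tau(v,w)$. (5) For each $v'$ and each $y$ labeling transitions from $v'$ to more than one vertex, keep $y$ only on the transition to a single vertex $w'$ such that $K_{w'}$ contains every state reached under $y$ from a state of $K_{v'}$, and remove $y$ from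 the other $\tau'(v',x')$. The induced clique cover is defined as follows. $v\in V(F)$ corresponds to $v'\in V(F')$ if $S_F(v)\cap S_{F'}(v')\neq\emptyset$. Let $K_{v'}=\{v:v\text{ corresponds to }v'\}$, and let $\mathcal Q(F,F')=\{K_{v'}:v'\in V(F')\}$.
   Formalization: Clause (2) of M(F,K) is corrected: if several cliques contain the initial state (where the literal M(F,K) has several initial vertices and is not deterministic), exactly one of them, chosen arbitrarily, is kept as initial; (i) is proved for every such choice and every choice in step (5). *)

theory Defs
  imports Main
begin

section \<open>P-filters\<close>

record ('v, 'y, 'c) pfilter =
  states :: "'v set"
  initials :: "'v set"
  observations :: "'y set"
  tau :: "'v \<Rightarrow> 'v \<Rightarrow> 'y set"
  outspace :: "'c set"
  out :: "'v \<Rightarrow> 'c set"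

definition is_pfilter :: "('v, 'y, 'c) pfilter \<Rightarrow> bool" where
  "is_pfilter F \<longleftrightarrow>
     finite (states F) \<and>
     initials F \<noteq> {} \<and> initials F \<subseteq> states F \<and>
     (\<forall>v\<in>states F. \<forall>w\<in>states F. tau F v w \<subseteq> observations F) \<and>
     (\<forall>v\<in>states F. out F v \<noteq> {} \<and> out F v \<subseteq> outspace F)"

definition single_outputting :: "('v, 'y, 'c) pfilter \<Rightarrow> bool" where
  "single_outputting F \<longleftrightarrow> (\<forall>v\<in>states F. card (out F v) = 1)"

definition deterministic :: "('v, 'y, 'c) pfilter \<Rightarrow> bool" where
  "deterministic F \<longleftrightarrow>
     card (initials F) = 1 \<and>
     (\<forall>v1\<in>states F. \<forall>v2\<in>states F. \<forall>v3\<in>states F.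
        v2 \<noteq> v3 \<longrightarrow> tau F v1 v2 \<inter> tau F v1 v3 = {})"

text \<open>
  In \<open>reached_from F w0 s\<close> the list \<open>ws\<close> is \<open>w\<^sub>1, \<dots>, w\<^sub>n\<close>, and \<open>(w0 # ws) ! i\<close>, \<open>ws ! i\<close>
  are the source and the target of the step reading \<open>s ! i\<close>. The transition function is total
  in HOL, so the states of a run are required to lie in the state set.
\<close>

definition reached_from :: "('v, 'y, 'c) pfilter \<Rightarrow> 'v \<Rightarrow> 'y list \<Rightarrow> 'v set" where
  "reached_from F w0 s =
     {last (w0 # ws) | ws. length ws = length s \<and> set ws \<subseteq> states F \<and>
        (\<forall>i<length s. s ! i \<in> tau F ((w0 # ws) ! i) (ws ! i))}"

definition reached :: "('v, 'y, 'c) pfilter \<Rightarrow> 'y list \<Rightarrow> 'v set" where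
  "reached F s = (\<Union>v0\<in>initials F. reached_from F v0 s)"

definition extensions :: "('v, 'y, 'c) pfilter \<Rightarrow> 'v \<Rightarrow> 'y list set" where
  "extensions F v = {s. reached_from F v s \<noteq> {}}"

definition language :: "('v, 'y, 'c) pfilter \<Rightarrow> 'y list set" where
  "language F = (\<Union>v0\<in>initials F. extensions F v0)"

definition outputs :: "('v, 'y, 'c) pfilter \<Rightarrow> 'y list \<Rightarrow> 'c set" where
  "outputs F s = (\<Union>v\<in>reached F s. out F v)"

definition reaching_strings :: "('v, 'y, 'c) pfilter \<Rightarrow> 'v \<Rightarrow> 'y list set" where
  "reaching_strings F v = {s. v \<in> reached F s}"

definition all_reachable :: "('v, 'y, 'c) pfilter \<Rightarrow> bool" where
  "all_reachable F \<longleftrightarrow> (\<forall>v\<in>states F. \<exists>v0\<in>initials F. \<exists>s. v \<in> reached_from F v0 s)"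

definition output_simulates :: "('w, 'y, 'c) pfilter \<Rightarrow> ('v, 'y, 'c) pfilter \<Rightarrow> bool" where
  "output_simulates F' F \<longleftrightarrow>
     (\<forall>s\<in>language F. outputs F' s \<noteq> {} \<and> outputs F' s \<subseteq> outputs F s)"

section \<open>Compatibility, clique covers and zipper constraints\<close>

definition compatible :: "('v, 'y, 'c) pfilter \<Rightarrow> 'v \<Rightarrow> 'v \<Rightarrow> bool" where
  "compatible F v w \<longleftrightarrow>
     (\<forall>s\<in>extensions F v \<inter> extensions F w.
        \<forall>v'\<in>reached_from F v s. \<forall>w'\<in>reached_from F w s. out F v' = out F w')"

definition mutually_compatible :: "('v, 'y, 'c) pfilter \<Rightarrow> 'v set \<Rightarrow> bool" where
  "mutually_compatible F U \<longleftrightarrow>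
     U \<subseteq> states F \<and> (\<forall>v\<in>U. \<forall>w\<in>U. v \<noteq> w \<longrightarrow> compatible F v w)"

definition compat_edges :: "('v, 'y, 'c) pfilter \<Rightarrow> 'v set set" where
  "compat_edges F =
     {{v, w} | v w. v \<in> states F \<and> w \<in> states F \<and> v \<noteq> w \<and> compatible F v w}"

definition compat_clique :: "('v, 'y, 'c) pfilter \<Rightarrow> 'v set \<Rightarrow> bool" where
  "compat_clique F K \<longleftrightarrow>
     K \<subseteq> states F \<and> (\<forall>v\<in>K. \<forall>w\<in>K. v \<noteq> w \<longrightarrow> {v, w} \<in> compat_edges F)"

definition clique_cover :: "('v, 'y, 'c) pfilter \<Rightarrow> 'v set set \<Rightarrow> bool" where
  "clique_cover F \<K> \<longleftrightarrow> (\<forall>K\<in>\<K>. compat_clique F K) \<and> \<Union>\<K> = states F"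

definition successors :: "('v, 'y, 'c) pfilter \<Rightarrow> 'v set \<Rightarrow> 'y \<Rightarrow> 'v set" where
  "successors F U y = {w \<in> states F. \<exists>u\<in>U. y \<in> tau F u w}"

definition Zip :: "('v, 'y, 'c) pfilter \<Rightarrow> ('v set \<times> 'v set \<times> 'y) set" where
  "Zip F = {(U, W, y). y \<in> observations F \<and> mutually_compatible F U \<and>
              mutually_compatible F W \<and> W = successors F U y}"

definition satisfies_Zip :: "('v, 'y, 'c) pfilter \<Rightarrow> 'v set set \<Rightarrow> bool" where
  "satisfies_Zip F \<K> \<longleftrightarrow>
     (\<forall>(U, W, y)\<in>Zip F. (\<exists>Ks\<in>\<K>. U \<subseteq> Ks) \<longrightarrow> (\<exists>Kt\<in>\<K>. W \<subseteq> Kt))"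

definition mcca_solution :: "('v, 'y, 'c) pfilter \<Rightarrow> 'v set set \<Rightarrow> bool" where
  "mcca_solution F \<K> \<longleftrightarrow>
     clique_cover F \<K> \<and> satisfies_Zip F \<K> \<and>
     (\<forall>\<L>. clique_cover F \<L> \<and> satisfies_Zip F \<L> \<longrightarrow> card \<K> \<le> card \<L>)"

lemma compat_clique_iff_mutually_compatible:
  "compat_clique F K \<longleftrightarrow> mutually_compatible F K"
proof -
  have sym: "compatible F v w \<longleftrightarrow> compatible F w v" for v w
    unfolding compatible_def by (auto 0 3)
  have "{v, w} \<in> compat_edges F \<longleftrightarrow> compatible F v w"
    if "v \<in> states F" "w \<in> states F" "v \<noteq> w" for v w
    using that sym unfolding compat_edges_def by (auto simp: doubleton_eq_iff)
  then show ?thesis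
    unfolding compat_clique_def mutually_compatible_def by blast
qed

section \<open>Minimal deterministic filters\<close>

text \<open>
  The competing filters have states in \<open>nat\<close>. As state sets are finite, every p-filter is
  isomorphic to one of these, so this is minimality among filters over any state type; see
  \<open>so_fm_solution_minimal\<close> below.
\<close>

definition so_fm_solution :: "('v, 'y, 'c) pfilter \<Rightarrow> ('w, 'y, 'c) pfilter \<Rightarrow> bool" where
  "so_fm_solution F F' \<longleftrightarrow>
     is_pfilter F' \<and> deterministic F' \<and> output_simulates F' F \<and>
     (\<forall>G :: (nat, 'y, 'c) pfilter.
        is_pfilter G \<and> deterministic G \<and> output_simulates G F \<longrightarrow>
        card (states F') \<le> card (states G))"

definition rename_states :: "('u \<Rightarrow> 'w) \<Rightarrow> ('u, 'y, 'c) pfilter \<Rightarrow> ('w, 'y, 'c) pfilter" where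
  "rename_states f G =
     \<lparr>states = f ` states G, initials = f ` initials G, observations = observations G,
      tau = (\<lambda>a b. tau G (inv_into (states G) f a) (inv_into (states G) f b)),
      outspace = outspace G, out = (\<lambda>a. out G (inv_into (states G) f a))\<rparr>"

lemma rename_states_sel [simp]:
  "states (rename_states f G) = f ` states G"
  "initials (rename_states f G) = f ` initials G"
  "observations (rename_states f G) = observations G"
  "outspace (rename_states f G) = outspace G"
  by (simp_all add: rename_states_def)

lemma tau_rename_states:
  assumes "inj_on f (states G)" "v \<in> states G" "w \<in> states G"
  shows "tau (rename_states f G) (f v) (f w) = tau G v w"
  using assms by (simp add: rename_states_def)

lemma out_rename_states:
  assumes "inj_on f (states G)" "v \<in> states G"
  shows "out (rename_states f G) (f v) = out G v"
  using assms by (simp add: rename_states_def)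

lemma reached_from_subset:
  assumes "v \<in> states G"
  shows "reached_from G v s \<subseteq> states G"
proof
  fix x assume "x \<in> reached_from G v s"
  then obtain ws where "x = last (v # ws)" "set ws \<subseteq> states G"
    unfolding reached_from_def by blast
  moreover have "last (v # ws) \<in> set (v # ws)" by (rule last_in_set) simp
  ultimately show "x \<in> states G" using assms by auto
qed

lemma reached_from_rename_states:
  assumes inj: "inj_on f (states G)" and v: "v \<in> states G"
  shows "reached_from (rename_states f G) (f v) s = f ` reached_from G v s"
proof -
  let ?H = "rename_states f G"
  have step: "(\<forall>i<length s. s ! i \<in> tau ?H ((f v # map f ws) ! i) (map f ws ! i)) \<longleftrightarrow>
      (\<forall>i<length s. s ! i \<in> tau G ((v # ws) ! i) (ws ! i))"
    if len: "length ws = length s" and sub: "set ws \<subseteq> states G" for ws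
  proof -
    have "tau ?H ((f v # map f ws) ! i) (map f ws ! i) = tau G ((v # ws) ! i) (ws ! i)"
      if i: "i < length s" for i
    proof -
      have "(v # ws) ! i \<in> set (v # ws)" using i len by (intro nth_mem) simp
      then have a: "(v # ws) ! i \<in> states G" using sub v by auto
      have b: "ws ! i \<in> states G" using i len sub by (metis nth_mem subsetD)
      have "(f v # map f ws) ! i = map f (v # ws) ! i" by simp
      also have "\<dots> = f ((v # ws) ! i)" using i len by (intro nth_map) simp
      finally show ?thesis using tau_rename_states[OF inj a b] i len by simp
    qed
    then show ?thesis by simp
  qed
  have last: "last (f v # map f ws) = f (last (v # ws))" for ws
    by (simp add: last_map)
  show ?thesis
  proof (intro equalityI subsetI)
    fix x assume "x \<in> reached_from ?H (f v) s"
    then obtain us where us: "x = last (f v # us)" "length us = length s" "set us \<subseteq> f ` states G"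
      "\<forall>i<length s. s ! i \<in> tau ?H ((f v # us) ! i) (us ! i)"
      unfolding reached_from_def by auto
    define ws where "ws = map (inv_into (states G) f) us"
    have ws: "us = map f ws" "set ws \<subseteq> states G"
      using us(3) unfolding ws_def
      by (auto simp: map_idI f_inv_into_f subset_iff intro!: map_idI[symmetric] inv_into_into)
    have "last (v # ws) \<in> reached_from G v s"
      using us ws step[of ws] unfolding reached_from_def by auto
    then show "x \<in> f ` reached_from G v s" using us(1) ws(1) last[of ws] by auto
  next
    fix x assume "x \<in> f ` reached_from G v s"
    then obtain ws where ws: "x = f (last (v # ws))" "length ws = length s" "set ws \<subseteq> states G"
      "\<forall>i<length s. s ! i \<in> tau G ((v # ws) ! i) (ws ! i)"
      unfolding reached_from_def by auto
    have "x = last (f v # map f ws)" using ws(1) last by simp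
    moreover have "set (map f ws) \<subseteq> states ?H" using ws(3) by auto
    moreover have "\<forall>i<length s. s ! i \<in> tau ?H ((f v # map f ws) ! i) (map f ws ! i)"
      using ws step[of ws] by blast
    ultimately show "x \<in> reached_from ?H (f v) s"
      using ws(2) unfolding reached_from_def by (intro CollectI exI[of _ "map f ws"]) simp
  qed
qed

lemma outputs_rename_states:
  assumes inj: "inj_on f (states G)" and G: "is_pfilter G"
  shows "outputs (rename_states f G) s = outputs G s"
proof -
  have init: "initials G \<subseteq> states G" using G by (simp add: is_pfilter_def)
  have "reached_from (rename_states f G) (f v) s = f ` reached_from G v s"
    if "v \<in> initials G" for v
    using that init reached_from_rename_states[OF inj] by blast
  then have "reached (rename_states f G) s = f ` reached G s"
    by (simp add: reached_def image_UN)
  moreover have "reached G s \<subseteq> states G"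
    using init reached_from_subset[of _ G s] unfolding reached_def by blast
  ultimately show ?thesis
    by (simp add: outputs_def out_rename_states[OF inj] subset_iff)
qed

lemma so_fm_solution_minimal:
  fixes G :: "('u, 'y, 'c) pfilter"
  assumes sol: "so_fm_solution F F'"
    and G: "is_pfilter G" "deterministic G" "output_simulates G F"
  shows "card (states F') \<le> card (states G)"
proof -
  have "finite (states G)" using G(1) by (simp add: is_pfilter_def)
  then obtain f :: "'u \<Rightarrow> nat" where inj: "inj_on f (states G)"
    using finite_imp_inj_to_nat_seg by blast
  let ?H = "rename_states f G"
  have init: "initials G \<subseteq> states G" using G(1) by (simp add: is_pfilter_def)
  have "is_pfilter ?H"
    using G(1) tau_rename_states[OF inj] out_rename_states[OF inj]
    unfolding is_pfilter_def by auto
  moreover have "deterministic ?H"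
    using G(2) card_image[OF inj_on_subset[OF inj init]]
    unfolding deterministic_def by (simp add: tau_rename_states[OF inj]) metis
  moreover have "output_simulates ?H F"
    using G(3) outputs_rename_states[OF inj G(1)] by (simp add: output_simulates_def)
  ultimately have "card (states F') \<le> card (states ?H)"
    using sol unfolding so_fm_solution_def by blast
  then show ?thesis using card_image[OF inj] by simp
qed

section \<open>The filter induced by a clique cover\<close>

text \<open>
  The vertices of the induced filter are the cliques themselves. \<open>merged_filter\<close> is the filter
  before determinization.
\<close>

definition merged_filter ::
  "('v, 'y, 'c) pfilter \<Rightarrow> 'v set set \<Rightarrow> ('v set, 'y, 'c) pfilter" where
  "merged_filter F \<K> =
     \<lparr>states = \<K>,
      initials = {K \<in> \<K>. K \<inter> initials F \<noteq> {}},
      observations = observations F,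
      tau = (\<lambda>K K'. \<Union>v\<in>K. \<Union>w\<in>K'. tau F v w),
      outspace = outspace F,
      out = (\<lambda>K. \<Inter>v\<in>K. out F v)\<rparr>"

definition ambiguous :: "('v, 'y, 'c) pfilter \<Rightarrow> 'v \<Rightarrow> 'y \<Rightarrow> bool" where
  "ambiguous F v y \<longleftrightarrow>
     (\<exists>w\<in>states F. \<exists>x\<in>states F. w \<noteq> x \<and> y \<in> tau F v w \<and> y \<in> tau F v x)"

text \<open>
  Determinizing the merged filter involves choices, so a cover induces a set of filters: all
  those obtained from some admissible choice. \<open>t K y\<close> is the clique to which the ambiguous
  observation \<open>y\<close> leaving \<open>K\<close> is redirected. Cliques of a cover may overlap, so several of them
  may contain the initial state; as the induced filter is meant to be deterministic, one of
  them, \<open>K0\<close>, is kept as the initial vertex.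
\<close>

definition induced_filters ::
  "('v, 'y, 'c) pfilter \<Rightarrow> 'v set set \<Rightarrow> ('v set, 'y, 'c) pfilter set" where
  "induced_filters F \<K> =
     {(merged_filter F \<K>)
        \<lparr>initials := {K0},
         tau := (\<lambda>K K'. {y \<in> tau (merged_filter F \<K>) K K'.
                             ambiguous (merged_filter F \<K>) K y \<longrightarrow> K' = t K y})\<rparr>
      | K0 t. K0 \<in> initials (merged_filter F \<K>) \<and>
          (\<forall>K\<in>\<K>. \<forall>y. ambiguous (merged_filter F \<K>) K y \<longrightarrow>
             t K y \<in> \<K> \<and> successors F K y \<subseteq> t K y)}"

section \<open>The clique cover induced by a filter\<close>

definition corresponds ::
  "('v, 'y, 'c) pfilter \<Rightarrow> ('w, 'y, 'c) pfilter \<Rightarrow> 'v \<Rightarrow> 'w \<Rightarrow> bool" where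
  "corresponds F F' v v' \<longleftrightarrow> reaching_strings F v \<inter> reaching_strings F' v' \<noteq> {}"

definition induced_cover ::
  "('v, 'y, 'c) pfilter \<Rightarrow> ('w, 'y, 'c) pfilter \<Rightarrow> 'v set set" where
  "induced_cover F F' = (\<lambda>v'. {v \<in> states F. corresponds F F' v v'}) ` states F'"

end

theory Submission imports Defs begin

text \<open>
  A cover satisfying the zipper constraints yields a deterministic filter with one state per
  clique; along every string read by \<open>F\<close>, the state reached in \<open>F\<close> stays inside the clique
  reached in the induced filter, so the outputs agree. Conversely, the states of \<open>F\<close> that
  correspond to one state of a deterministic simulating filter share all their future outputs
  and hence form a clique, and their \<open>y\<close>-successors all correspond to its unique
  \<open>y\<close>-successor. Both passages do not increase the size, so the two minima agree.
\<close>

section \<open>Runs\<close>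

lemma reached_from_Nil [simp]: "reached_from F v [] = {v}"
  by (auto simp: reached_from_def)

text \<open>Replaces the indexed description of runs by a recursion on the string, so that runs can
  be split and handled by induction.\<close>

lemma reached_from_Cons:
  "reached_from F v (y # s) = (\<Union>w\<in>successors F {v} y. reached_from F w s)"
proof (intro equalityI subsetI)
  fix x assume "x \<in> reached_from F v (y # s)"
  then obtain us where us: "x = last (v # us)" "length us = length (y # s)" "set us \<subseteq> states F"
    "\<forall>i<length (y # s). (y # s) ! i \<in> tau F ((v # us) ! i) (us ! i)"
    unfolding reached_from_def by blast
  then obtain w ws where ws: "us = w # ws" by (cases us) auto
  have "y \<in> tau F v w" using us(4) ws by auto
  moreover have "\<forall>i<length s. s ! i \<in> tau F ((w # ws) ! i) (ws ! i)"
  proof (intro allI impI)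
    fix i assume "i < length s"
    then show "s ! i \<in> tau F ((w # ws) ! i) (ws ! i)"
      using us(4)[rule_format, of "Suc i"] ws by simp
  qed
  ultimately have "w \<in> successors F {v} y" "x \<in> reached_from F w s"
    using us(1-3) ws by (auto simp: successors_def reached_from_def)
  then show "x \<in> (\<Union>w\<in>successors F {v} y. reached_from F w s)" by blast
next
  fix x assume "x \<in> (\<Union>w\<in>successors F {v} y. reached_from F w s)"
  then obtain w ws where w: "w \<in> states F" "y \<in> tau F v w"
    and ws: "x = last (w # ws)" "length ws = length s" "set ws \<subseteq> states F"
      "\<forall>i<length s. s ! i \<in> tau F ((w # ws) ! i) (ws ! i)"
    unfolding reached_from_def successors_def by blast
  have "\<forall>i<length (y # s). (y # s) ! i \<in> tau F ((v # w # ws) ! i) ((w # ws) ! i)"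
    using w ws(4) by (auto simp: nth_Cons split: nat.split)
  then show "x \<in> reached_from F v (y # s)"
    using w ws(1-3) unfolding reached_from_def
    by (intro CollectI exI[of _ "w # ws"]) auto
qed

lemma reached_from_append:
  "reached_from F v (s @ r) = (\<Union>w\<in>reached_from F v s. reached_from F w r)"
  by (induction s arbitrary: v) (auto simp: reached_from_Cons)

lemma reached_append:
  "reached F (s @ r) = (\<Union>w\<in>reached F s. reached_from F w r)"
  by (auto simp: reached_def reached_from_append)

lemma reached_from_singleton: "reached_from F w [y] = successors F {w} y"
  by (simp add: reached_from_Cons)

lemma language_iff_reached: "s \<in> language F \<longleftrightarrow> reached F s \<noteq> {}"
  by (auto simp: language_def extensions_def reached_def)

lemma reached_subset:
  assumes "is_pfilter F"
  shows "reached F s \<subseteq> states F"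
  using assms reached_from_subset[of _ F s] unfolding is_pfilter_def reached_def by blast

lemma deterministic_successor_unique:
  assumes "deterministic F" "v \<in> states F" "w \<in> successors F {v} y" "x \<in> successors F {v} y"
  shows "w = x"
  using assms unfolding deterministic_def successors_def by blast

lemma deterministic_reached_from_unique:
  assumes "deterministic F" "v \<in> states F" "w \<in> reached_from F v s" "x \<in> reached_from F v s"
  shows "w = x"
  using assms(2-4)
proof (induction s arbitrary: v)
  case (Cons y s)
  then obtain a b where ab: "a \<in> successors F {v} y" "w \<in> reached_from F a s"
    "b \<in> successors F {v} y" "x \<in> reached_from F b s"
    by (auto simp: reached_from_Cons)
  then have "a = b" using deterministic_successor_unique[OF assms(1) Cons.prems(1)] by blast
  moreover have "a \<in> states F" using ab(1) by (simp add: successors_def)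
  ultimately show ?case using Cons.IH ab by blast
qed simp

lemma deterministic_reached_unique:
  assumes "is_pfilter F" "deterministic F" "w \<in> reached F s" "x \<in> reached F s"
  shows "w = x"
proof -
  obtain v0 where v0: "initials F = {v0}"
    using assms(2) by (auto simp: deterministic_def card_1_singleton_iff)
  then have "v0 \<in> states F" using assms(1) by (auto simp: is_pfilter_def)
  then show ?thesis
    using deterministic_reached_from_unique[OF assms(2)] assms(3,4) v0 by (auto simp: reached_def)
qed

section \<open>Clique covers\<close>

text \<open>The empty string is an extension of every state, so compatibility already compares the
  outputs of the two states themselves.\<close>

lemma mutually_compatible_out_eq:
  assumes "mutually_compatible F K" "v \<in> K" "w \<in> K"
  shows "out F v = out F w"
proof (cases "v = w")
  case False
  then have "compatible F v w" using assms by (auto simp: mutually_compatible_def)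
  moreover have "[] \<in> extensions F v \<inter> extensions F w" by (simp add: extensions_def)
  ultimately show ?thesis unfolding compatible_def by (metis reached_from_Nil singletonI)
qed simp

text \<open>Distinct \<open>y\<close>-successors have distinct predecessors by determinism, and
  prefixing \<open>y\<close> turns a common extension of the successors into one of the compatible
  predecessors. Thus every clique and observation give rise to a zipper constraint.\<close>

lemma mutually_compatible_successors:
  assumes "deterministic F" "mutually_compatible F K"
  shows "mutually_compatible F (successors F K y)"
  unfolding mutually_compatible_def
proof (intro conjI ballI impI)
  show "successors F K y \<subseteq> states F" by (auto simp: successors_def)
  fix w x assume wx: "w \<in> successors F K y" "x \<in> successors F K y" "w \<noteq> x"
  then obtain u v where uv: "u \<in> K" "w \<in> successors F {u} y" "v \<in> K" "x \<in> successors F {v} y"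
    by (auto simp: successors_def)
  have "u \<in> states F" using assms(2) uv(1) by (auto simp: mutually_compatible_def)
  then have "u \<noteq> v" using deterministic_successor_unique[OF assms(1)] uv wx(3) by blast
  then have comp: "compatible F u v" using assms(2) uv by (auto simp: mutually_compatible_def)
  have "reached_from F w s \<subseteq> reached_from F u (y # s)"
    "reached_from F x s \<subseteq> reached_from F v (y # s)" for s
    using uv by (auto simp: reached_from_Cons)
  then show "compatible F w x" using comp unfolding compatible_def extensions_def by blast
qed

lemma clique_cover_mutually_compatible:
  assumes "clique_cover F \<K>" "K \<in> \<K>"
  shows "mutually_compatible F K"
  using assms by (simp add: clique_cover_def compat_clique_iff_mutually_compatible)

lemma clique_cover_finite:
  assumes "is_pfilter F" "clique_cover F \<K>"
  shows "finite \<K>"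
proof (rule finite_subset)
  show "\<K> \<subseteq> Pow (states F)" using assms(2) by (auto simp: clique_cover_def)
  show "finite (Pow (states F))" using assms(1) by (simp add: is_pfilter_def)
qed

lemma satisfies_Zip_iff:
  "satisfies_Zip F \<K> \<longleftrightarrow>
     (\<forall>U W y. (U, W, y) \<in> Zip F \<longrightarrow> (\<exists>Ks\<in>\<K>. U \<subseteq> Ks) \<longrightarrow> (\<exists>Kt\<in>\<K>. W \<subseteq> Kt))"
  by (auto simp: satisfies_Zip_def)

lemma satisfies_Zip_successors:
  assumes "deterministic F" "clique_cover F \<K>" "satisfies_Zip F \<K>" "K \<in> \<K>"
    "y \<in> observations F"
  shows "\<exists>K'\<in>\<K>. successors F K y \<subseteq> K'"
proof -
  have K: "mutually_compatible F K" using assms clique_cover_mutually_compatible by blast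
  then have "(K, successors F K y, y) \<in> Zip F"
    using mutually_compatible_successors[OF assms(1)] assms(5) by (simp add: Zip_def)
  then show ?thesis using assms(3,4) unfolding satisfies_Zip_iff by blast
qed

text \<open>The empty set is a clique but makes no sensible state of an induced filter. A constraint
  whose target lay in the empty clique has empty target, so any remaining clique meets it; one
  remains because \<open>F\<close> has a state.\<close>

lemma clique_cover_remove_empty:
  assumes "is_pfilter F" "clique_cover F \<K>" "satisfies_Zip F \<K>"
  shows "clique_cover F (\<K> - {{}})" "satisfies_Zip F (\<K> - {{}})"
proof -
  show cover: "clique_cover F (\<K> - {{}})" using assms(2) by (auto simp: clique_cover_def)
  have "states F \<noteq> {}" using assms(1) by (auto simp: is_pfilter_def)
  then obtain K where K: "K \<in> \<K> - {{}}" using cover by (auto simp: clique_cover_def)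
  have "\<exists>Kt\<in>\<K> - {{}}. W \<subseteq> Kt"
    if zip: "(U, W, y) \<in> Zip F" "Ks \<in> \<K> - {{}}" "U \<subseteq> Ks" for U W y Ks
  proof -
    obtain Kt where "Kt \<in> \<K>" "W \<subseteq> Kt" using zip assms(3) unfolding satisfies_Zip_iff by blast
    then show ?thesis using K by (cases "Kt = {}") auto
  qed
  then show "satisfies_Zip F (\<K> - {{}})" unfolding satisfies_Zip_iff by blast
qed

lemma mcca_solution_no_empty:
  assumes "is_pfilter F" "mcca_solution F \<K>"
  shows "{} \<notin> \<K>"
proof
  assume empty: "{} \<in> \<K>"
  have \<K>: "clique_cover F \<K>" "satisfies_Zip F \<K>" using assms(2) by (auto simp: mcca_solution_def)
  then have "card \<K> \<le> card (\<K> - {{}})"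
    using assms(2) clique_cover_remove_empty[OF assms(1)] unfolding mcca_solution_def by blast
  moreover have "card (\<K> - {{}}) < card \<K>"
    using clique_cover_finite[OF assms(1) \<K>(1)] empty by (rule card_Diff1_less)
  ultimately show False by simp
qed

section \<open>The induced filter\<close>

lemma merged_filter_sel [simp]:
  "states (merged_filter F \<K>) = \<K>"
  "initials (merged_filter F \<K>) = {K \<in> \<K>. K \<inter> initials F \<noteq> {}}"
  "observations (merged_filter F \<K>) = observations F"
  "tau (merged_filter F \<K>) = (\<lambda>K K'. \<Union>v\<in>K. \<Union>w\<in>K'. tau F v w)"
  "outspace (merged_filter F \<K>) = outspace F"
  "out (merged_filter F \<K>) = (\<lambda>K. \<Inter>v\<in>K. out F v)"
  by (simp_all add: merged_filter_def)

lemma tau_merged_filter_subset: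
  assumes "is_pfilter F" "clique_cover F \<K>" "K \<in> \<K>" "K' \<in> \<K>"
  shows "tau (merged_filter F \<K>) K K' \<subseteq> observations F"
proof
  fix y assume "y \<in> tau (merged_filter F \<K>) K K'"
  then obtain v w where "v \<in> K" "w \<in> K'" "y \<in> tau F v w" by auto
  moreover from this have "v \<in> states F" "w \<in> states F"
    using assms(2-4) by (auto simp: clique_cover_def)
  ultimately show "y \<in> observations F" using assms(1) unfolding is_pfilter_def by blast
qed

text \<open>Guarantees that the choices made in determinizing exist, so that claims about all
  induced filters are not vacuous and a cover can be turned into a filter.\<close>

lemma induced_filters_nonempty:
  assumes "is_pfilter F" "deterministic F" "clique_cover F \<K>" "satisfies_Zip F \<K>"
  shows "induced_filters F \<K> \<noteq> {}"
proof -
  let ?m = "merged_filter F \<K>"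
  obtain v0 where v0: "v0 \<in> initials F" "v0 \<in> states F"
    using assms(1) by (auto simp: is_pfilter_def)
  then obtain K0 where "v0 \<in> K0" "K0 \<in> \<K>" using assms(3) unfolding clique_cover_def by blast
  then have K0: "K0 \<in> initials ?m" using v0(1) by auto
  have "\<exists>K'. K' \<in> \<K> \<and> successors F K y \<subseteq> K'" if "K \<in> \<K>" "ambiguous ?m K y" for K y
  proof -
    \<comment> \<open>\<open>Zip\<close> ranges over observations only, so this membership must come
      first.\<close>
    have "y \<in> observations F"
      using that tau_merged_filter_subset[OF assms(1,3)]
      unfolding ambiguous_def merged_filter_sel(1) by blast
    then show ?thesis using satisfies_Zip_successors[OF assms(2-4)] that(1) by blast
  qed
  then have "\<forall>K y. \<exists>K'. K \<in> \<K> \<longrightarrow> ambiguous ?m K y \<longrightarrow> K' \<in> \<K> \<and> successors F K y \<subseteq> K'"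
    by blast
  then obtain t where
    "\<forall>K y. K \<in> \<K> \<longrightarrow> ambiguous ?m K y \<longrightarrow> t K y \<in> \<K> \<and> successors F K y \<subseteq> t K y"
    by metis
  then show ?thesis using K0 unfolding induced_filters_def by blast
qed

lemma induced_filter_correct:
  assumes F: "is_pfilter F" "deterministic F"
    and \<K>: "clique_cover F \<K>" "{} \<notin> \<K>"
    and M: "M \<in> induced_filters F \<K>"
  shows "is_pfilter M" "deterministic M" "output_simulates M F" "states M = \<K>"
proof -
  let ?m = "merged_filter F \<K>"
  obtain K0 t where init: "K0 \<in> initials ?m"
    and t: "\<And>K y. K \<in> \<K> \<Longrightarrow> ambiguous ?m K y \<Longrightarrow> t K y \<in> \<K> \<and> successors F K y \<subseteq> t K y"
    and M_eq: "M = ?m\<lparr>initials := {K0},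
         tau := (\<lambda>K K'. {y \<in> tau ?m K K'. ambiguous ?m K y \<longrightarrow> K' = t K y})\<rparr>"
    using M unfolding induced_filters_def by blast
  have K0: "K0 \<in> \<K>" "K0 \<inter> initials F \<noteq> {}" using init by auto
  have sel: "states M = \<K>" "initials M = {K0}" "observations M = observations F"
    "outspace M = outspace F" "\<And>K. out M K = (\<Inter>v\<in>K. out F v)"
    "\<And>K K' y. y \<in> tau M K K' \<longleftrightarrow> y \<in> tau ?m K K' \<and> (ambiguous ?m K y \<longrightarrow> K' = t K y)"
    using M_eq by auto
  show "states M = \<K>" by (fact sel)
  have sub: "K \<subseteq> states F" if "K \<in> \<K>" for K
    using that \<K>(1) by (auto simp: clique_cover_def)
  \<comment> \<open>All members of a clique have the same output, so intersecting over a clique with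
    a member \<open>v\<close> returns that output.\<close>
  have out_eq: "out M K = out F v" if "K \<in> \<K>" "v \<in> K" for K v
    using mutually_compatible_out_eq[OF clique_cover_mutually_compatible[OF \<K>(1) that(1)]] that(2)
    unfolding sel(5) by blast
  show pM: "is_pfilter M"
    unfolding is_pfilter_def
  proof (intro conjI ballI)
    show "finite (states M)" using clique_cover_finite[OF F(1) \<K>(1)] sel by simp
    show "initials M \<noteq> {}" "initials M \<subseteq> states M" using K0 sel by auto
    show "tau M K K' \<subseteq> observations M" if "K \<in> states M" "K' \<in> states M" for K K'
      using that tau_merged_filter_subset[OF F(1) \<K>(1)] unfolding sel(1,3) subset_iff sel(6)
      by blast
    fix K assume "K \<in> states M"
    moreover from this obtain v where "v \<in> K" "v \<in> states F"
      using \<K>(2) sub sel(1) by (metis equals0I subsetD)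
    ultimately show "out M K \<noteq> {}" "out M K \<subseteq> outspace M"
      using out_eq F(1) sel by (auto simp: is_pfilter_def)
  qed
  show dM: "deterministic M"
    unfolding deterministic_def
  proof (intro conjI ballI impI)
    show "card (initials M) = 1" by (simp add: sel)
    fix K K1 K2 assume "K \<in> states M" "K1 \<in> states M" "K2 \<in> states M" "K1 \<noteq> K2"
    \<comment> \<open>An observation leading to both \<open>K1\<close> and \<open>K2\<close> would
      be ambiguous in the merged filter, and then both would equal \<open>t K y\<close>.\<close>
    then show "tau M K K1 \<inter> tau M K K2 = {}"
      unfolding sel(1) disjoint_iff sel(6) ambiguous_def merged_filter_sel(1) by metis
  qed
  \<comment> \<open>The induction appends letters at the end, because the next clique depends on the
    clique reached so far.\<close>
  have invariant: "v \<in> reached F s \<Longrightarrow> \<exists>K\<in>reached M s. v \<in> K" for v s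
  proof (induction s arbitrary: v rule: rev_induct)
    case Nil
    \<comment> \<open>\<open>K0\<close> is only known to meet the initial states; as there is
      exactly one, it contains it.\<close>
    moreover have "initials F \<subseteq> K0"
      using F(2) K0(2) by (auto simp: deterministic_def card_1_singleton_iff)
    ultimately show ?case using sel by (auto simp: reached_def)
  next
    case (snoc y s)
    then obtain u where u: "u \<in> reached F s" "v \<in> successors F {u} y"
      by (auto simp: reached_append reached_from_singleton)
    then obtain K where K: "K \<in> reached M s" "u \<in> K" using snoc.IH by blast
    have K\<K>: "K \<in> \<K>" using reached_subset[OF pM] K sel by blast
    have v: "v \<in> states F" "y \<in> tau F u v" using u(2) by (auto simp: successors_def)
    have tau_m: "y \<in> tau ?m K K'" if "v \<in> K'" for K' using that v K by auto
    have "\<exists>K'\<in>\<K>. v \<in> K' \<and> y \<in> tau M K K'"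
    \<comment> \<open>If \<open>y\<close> was redirected, its target \<open>t K y\<close> contains
      all successors of \<open>K\<close>, in particular \<open>v\<close>. Otherwise no transition
      under \<open>y\<close> was removed, and any clique covering \<open>v\<close> serves.\<close>
    proof (cases "ambiguous ?m K y")
      case True
      moreover have "v \<in> successors F K y" using v K(2) by (auto simp: successors_def)
      ultimately have "t K y \<in> \<K>" "v \<in> t K y" using t K\<K> by blast+
      then show ?thesis using tau_m sel(6) by blast
    next
      case False
      obtain K' where "K' \<in> \<K>" "v \<in> K'" using v(1) \<K>(1) by (auto simp: clique_cover_def)
      then show ?thesis using False tau_m sel(6) by blast
    qed
    then obtain K' where "K' \<in> successors M {K} y" "v \<in> K'"
      using sel(1) by (auto simp: successors_def)
    then show ?case using K(1) by (auto simp: reached_append reached_from_singleton)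
  qed
  show "output_simulates M F"
    unfolding output_simulates_def
  proof
    fix s assume "s \<in> language F"
    then obtain v where v: "v \<in> reached F s" by (auto simp: language_iff_reached)
    then obtain K where K: "K \<in> reached M s" "v \<in> K" using invariant by blast
    have "K \<in> \<K>" using reached_subset[OF pM] K sel by blast
    then have "out M K = out F v" using out_eq K by blast
    \<comment> \<open>No second clique can contribute a foreign output.\<close>
    moreover have "reached M s = {K}" using deterministic_reached_unique[OF pM dM] K by blast
    moreover have "v \<in> states F" using reached_subset[OF F(1)] v by blast
    ultimately show "outputs M s \<noteq> {} \<and> outputs M s \<subseteq> outputs F s"
      using F(1) v by (auto simp: outputs_def is_pfilter_def)
  qed
qed

section \<open>The induced clique cover\<close>

text \<open>The cardinality bound is only an inequality because different states of \<open>G\<close>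
  may induce the same set of states of \<open>F\<close>.\<close>

lemma induced_cover_correct:
  assumes F: "is_pfilter F" "deterministic F" "single_outputting F" "all_reachable F"
    and G: "is_pfilter G" "deterministic G" "output_simulates G F"
  shows "clique_cover F (induced_cover F G)" "satisfies_Zip F (induced_cover F G)"
    "card (induced_cover F G) \<le> card (states G)"
proof -
  let ?K = "\<lambda>v'. {v \<in> states F. corresponds F G v v'}"
  have finG: "finite (states G)" using G(1) by (simp add: is_pfilter_def)
  then show "card (induced_cover F G) \<le> card (states G)"
    unfolding induced_cover_def by (rule card_image_le)
  \<comment> \<open>Once some string \<open>s\<close> leads to both \<open>v\<close> and
    \<open>v'\<close>, every run of \<open>F\<close> from \<open>v\<close> is matched by a run of
    \<open>G\<close> from \<open>v'\<close> that ends with the same output. Simulation yields a run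
    of \<open>G\<close> on \<open>s @ r\<close>, and determinism makes it pass through
    \<open>v'\<close>.\<close>
  have follow: "\<exists>x. x \<in> reached_from G v' r \<and> s @ r \<in> reaching_strings G x \<and> out G x = out F w"
    if v: "s \<in> reaching_strings F v" "s \<in> reaching_strings G v'" and w: "w \<in> reached_from F v r"
    for s r v v' w
  proof -
    have wr: "w \<in> reached F (s @ r)"
      using v(1) w by (auto simp: reaching_strings_def reached_append)
    then have "s @ r \<in> language F" by (auto simp: language_iff_reached)
    then have sim: "outputs G (s @ r) \<noteq> {}" "outputs G (s @ r) \<subseteq> outputs F (s @ r)"
      using G(3) by (auto simp: output_simulates_def)
    then obtain x where x: "x \<in> reached G (s @ r)" by (auto simp: outputs_def)
    then obtain z where "z \<in> reached G s" "x \<in> reached_from G z r" by (auto simp: reached_append)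
    then have xr: "x \<in> reached_from G v' r"
      using deterministic_reached_unique[OF G(1,2)] v(2) by (auto simp: reaching_strings_def)
    have "reached F (s @ r) = {w}" using deterministic_reached_unique[OF F(1,2)] wr by blast
    then have "out G x \<subseteq> out F w" using x sim by (auto simp: outputs_def)
    moreover have "out G x \<noteq> {}"
      using subsetD[OF reached_subset[OF G(1)] x] G(1) by (auto simp: is_pfilter_def)
    moreover have "\<exists>c. out F w = {c}"
      using F(3) subsetD[OF reached_subset[OF F(1)] wr]
      by (auto simp: single_outputting_def card_1_singleton_iff)
    \<comment> \<open>A nonempty subset of a singleton is the whole singleton; here single outputs
      turn simulation into equality.\<close>
    ultimately have "out G x = out F w" by auto
    then show ?thesis using x xr by (auto simp: reaching_strings_def)
  qed
  have clique: "mutually_compatible F (?K v')" if v': "v' \<in> states G" for v'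
    unfolding mutually_compatible_def
  proof (intro conjI ballI impI)
    fix v w assume "v \<in> ?K v'" "w \<in> ?K v'"
    then obtain s1 s2 where
      s: "s1 \<in> reaching_strings F v" "s1 \<in> reaching_strings G v'"
         "s2 \<in> reaching_strings F w" "s2 \<in> reaching_strings G v'"
      by (auto simp: corresponds_def)
    show "compatible F v w"
      unfolding compatible_def
    proof (intro ballI)
      fix r a b assume "a \<in> reached_from F v r" "b \<in> reached_from F w r"
      \<comment> \<open>Both outputs equal that of the single state which \<open>G\<close> reaches
        from \<open>v'\<close> along \<open>r\<close>, although \<open>v\<close> and
        \<open>w\<close> may be reached by different strings.\<close>
      then show "out F a = out F b"
        using follow[OF s(1,2)] follow[OF s(3,4)]
          deterministic_reached_from_unique[OF G(2) v'] by metis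
    qed
  qed auto
  \<comment> \<open>A string reaching \<open>v\<close> belongs to the language of \<open>F\<close>,
    so \<open>G\<close> must read it too and ends in a state corresponding to
    \<open>v\<close>.\<close>
  have "\<exists>v'\<in>states G. v \<in> ?K v'" if v: "v \<in> states F" for v
  proof -
    obtain s where s: "v \<in> reached F s"
      using F(4) v unfolding all_reachable_def reached_def by blast
    then have "s \<in> language F" by (auto simp: language_iff_reached)
    then have "outputs G s \<noteq> {}" using G(3) by (simp add: output_simulates_def)
    then obtain v' where "v' \<in> reached G s" by (auto simp: outputs_def)
    then show ?thesis
      using s v reached_subset[OF G(1)] by (auto simp: corresponds_def reaching_strings_def)
  qed
  then have "\<Union>(induced_cover F G) = states F" unfolding induced_cover_def by blast
  then show "clique_cover F (induced_cover F G)"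
    using clique
    by (auto simp: clique_cover_def compat_clique_iff_mutually_compatible induced_cover_def)
  have zip: "\<exists>w'\<in>states G. successors F U y \<subseteq> ?K w'"
    if v': "v' \<in> states G" and U: "U \<subseteq> ?K v'" for U y v'
  proof -
    have succ: "\<exists>x. x \<in> successors G {v'} y \<and> w \<in> ?K x" if w: "w \<in> successors F U y" for w
    proof -
      obtain u where u: "u \<in> U" "w \<in> successors F {u} y"
        using w by (auto simp: successors_def)
      then obtain s where s: "s \<in> reaching_strings F u" "s \<in> reaching_strings G v'"
        using U by (auto simp: corresponds_def)
      then obtain x where x: "x \<in> successors G {v'} y" "s @ [y] \<in> reaching_strings G x"
        using follow[of s u v' w "[y]"] u(2) by (auto simp: reached_from_singleton)
      have "s @ [y] \<in> reaching_strings F w"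
        using s(1) u(2) by (auto simp: reaching_strings_def reached_append reached_from_singleton)
      then show ?thesis using x w by (auto simp: corresponds_def successors_def)
    qed
    show ?thesis
    \<comment> \<open>Without successors in \<open>F\<close>, the state \<open>v'\<close> need not
      have a \<open>y\<close>-transition, so \<open>v'\<close> itself serves as the witness.\<close>
    proof (cases "successors F U y = {}")
      case True
      then show ?thesis using v' by blast
    next
      case False
      then obtain x where x: "x \<in> successors G {v'} y" using succ by blast
      then have "successors F U y \<subseteq> ?K x"
        using succ deterministic_successor_unique[OF G(2) v'] by blast
      then show ?thesis using x by (auto simp: successors_def)
    qed
  qed
  show "satisfies_Zip F (induced_cover F G)"
    unfolding satisfies_Zip_iff
  proof (intro allI impI)
    fix U W y assume "(U, W, y) \<in> Zip F" and "\<exists>Ks\<in>induced_cover F G. U \<subseteq> Ks"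
    then have W: "W = successors F U y" and "\<exists>v'\<in>states G. U \<subseteq> ?K v'"
      by (simp_all add: Zip_def induced_cover_def)
    then obtain v' where "v' \<in> states G" "U \<subseteq> ?K v'" by (elim bexE)
    then have "\<exists>w'\<in>states G. W \<subseteq> ?K w'" unfolding W by (rule zip)
    then show "\<exists>Kt\<in>induced_cover F G. W \<subseteq> Kt" by (simp add: induced_cover_def)
  qed
qed

section \<open>Equivalence of the two minimization problems\<close>

theorem theorem2:
  fixes F :: "('v, 'y, 'c) pfilter"
  assumes "is_pfilter F"
    and "deterministic F"
    and "single_outputting F"
    and "all_reachable F"
  shows "(\<forall>\<K>. mcca_solution F \<K> \<longrightarrow>
            induced_filters F \<K> \<noteq> {} \<and>
            (\<forall>M\<in>induced_filters F \<K>. so_fm_solution F M)) \<and>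
         (\<forall>Fstar :: ('w, 'y, 'c) pfilter. so_fm_solution F Fstar \<longrightarrow>
            mcca_solution F (induced_cover F Fstar))"
proof (intro conjI allI impI ballI)
  fix \<K> assume sol: "mcca_solution F \<K>"
  then have \<K>: "clique_cover F \<K>" "satisfies_Zip F \<K>" by (auto simp: mcca_solution_def)
  show "induced_filters F \<K> \<noteq> {}" using induced_filters_nonempty assms(1,2) \<K> by blast
  fix M assume "M \<in> induced_filters F \<K>"
  note M = induced_filter_correct[OF assms(1,2) \<K>(1) mcca_solution_no_empty[OF assms(1) sol] this]
  \<comment> \<open>The cover induced by the competitor \<open>G\<close> competes with
    \<open>\<K>\<close> and has at most as many cliques as \<open>G\<close> has states.\<close>
  have "card \<K> \<le> card (states G)"
    if "is_pfilter G" "deterministic G" "output_simulates G F" for G :: "(nat, 'y, 'c) pfilter"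
    using sol induced_cover_correct[OF assms that] unfolding mcca_solution_def
    by (meson le_trans)
  then show "so_fm_solution F M" using M by (simp add: so_fm_solution_def)
next
  fix Fstar :: "('w, 'y, 'c) pfilter" assume sol: "so_fm_solution F Fstar"
  then have "is_pfilter Fstar" "deterministic Fstar" "output_simulates Fstar F"
    by (auto simp: so_fm_solution_def)
  note Q = induced_cover_correct[OF assms this]
  have "card (induced_cover F Fstar) \<le> card \<L>"
    if \<L>: "clique_cover F \<L>" "satisfies_Zip F \<L>" for \<L>
  proof -
    \<comment> \<open>An empty clique would output the junk value \<open>\<Inter>{} = UNIV\<close>.\<close>
    let ?L = "\<L> - {{}}"
    note L = clique_cover_remove_empty[OF assms(1) \<L>]
    obtain M where "M \<in> induced_filters F ?L"
      using induced_filters_nonempty[OF assms(1,2) L] by blast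
    note M = induced_filter_correct[OF assms(1,2) L(1) _ this]
    \<comment> \<open>The states of \<open>M\<close> are sets of states of \<open>F\<close>, so
      minimality is needed over arbitrary state types and not only over \<open>nat\<close>.\<close>
    have "card (states Fstar) \<le> card ?L"
      using so_fm_solution_minimal[OF sol M(1-3)] M(4) by simp
    also have "\<dots> \<le> card \<L>"
      using clique_cover_finite[OF assms(1) \<L>(1)] by (intro card_mono) auto
    finally show ?thesis using Q(3) by linarith
  qed
  then show "mcca_solution F (induced_cover F Fstar)" using Q by (simp add: mcca_solution_def)
qed

end
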